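(* Let $\mathcal{L}^{\Delta}:Y\to\mathbb{R}$ be the (numerically approximated) parameters to observable map on $Y=[0,1]^d$ with $\mu$ the Lebesgue measure on $Y$, let $\hat\mu^{\Delta}=\mathcal{L}^{\Delta}\#\mu$, and let $\mathcal{L}^{\ast}:Y\to\mathbb{R}$ be the surrogate map (a trained neural network) used in the deep learning quasi-Monte Carlo (DLQMC) algorithm described in the context, trained on $N$ samples of $\mathcal{L}^{\Delta}$. Let $\epsilon>0$ be a given tolerance and assume: (1) the generalization error satisfies $\mathcal{E}_G=\left(\int_Y|\mathcal{L}^{\Delta}(y)-\mathcal{L}^{\ast}(y)|^p\,d\mu(y)\right)^{1/p}=\mathcal{O}(\epsilon)$ for some $1\le p\le\infty$ (with the essential supremum for $p=\infty$); (2) the baseline quasi-Monte Carlo (QMC) estimator $\hat\mu_{qmc}=\frac1{J}\sum_{j=1}^{J}\delta_{\mathcal{L}^{\Delta}(y_j)}$ of $\hat\mu^{\Delta}$ satisfies $W_1(\hat\mu^{\Delta},\hat\mu_{qmc})\sim\left(V^{\Delta}/J\right)^{\alpha}$ for some $1/2<\alpha\le1$ and some $V^\Delta>0$; (3) $V^{\ast}=V(\mathcal{L}^{\ast})>0$ is the corresponding variation for $\mathcal{L}^{\ast}$, i.e. $\hat\mu^{\ast}_{qmc}=\frac1{J}\sum_{j=1}^{J}\delta_{\mathcal{L}^{\ast}(y_j)}$ satisfies $W_1(\mathcal{L}^{\ast}\#\mu,\hat\mu^{\ast}_{qmc})\sim\left(V^{\ast}/J\right)^{\alpha}$ with the same $\alpha$.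 Let $J_q$ be the number of points of the baseline QMC algorithm, chosen so that its error estimate in (2) is of size $\epsilon$, i.e. $J_q\sim V^{\Delta}\epsilon^{-1/\alpha}$, and let $J_L$ be the number of points of the DLQMC algorithm, chosen so that the estimate in (3) is of size $\epsilon$, i.e. $J_L\sim V^{\ast}\epsilon^{-1/\alpha}$. Then both $\hat\mu_{qmc}$ (with $J_q$ points) and the DLQMC output $\hat\mu^{\ast}_{qmc}$ (with $J_L$ points) approximate $\hat\mu^{\Delta}$ to an error of size $\mathcal{O}(\epsilon)$ in the $1$-Wasserstein metric, and the speedup $\Sigma_{dlqmc}$, defined as the ratio of the cost of the baseline QMC algorithm to the cost of the DLQMC algorithm, satisfies $$\frac{1}{\Sigma_{dlqmc}}\sim\frac{N}{J_q}+\frac{\mathcal{C}_{\ast}}{\mathcal{C}}\,\frac{V^{\ast}}{V^{\Delta}},$$ where $\mathcal{C}>0$ and $\mathcal{C}_{\ast}>0$ are the computational costs of a single evaluation of $\mathcal{L}^{\Delta}(y)$ and of $\mathcal{L}^{\ast}(y)$, respectively, for any $y\in Y$.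
   Context: **Setting.** $Y=[0,1]^d$ is the parameter space, $\mu$ the Lebesgue measure on $Y$. $\mathcal{L}^{\Delta}:Y\to\mathbb{R}$ is a measurable map (in the application, an observable computed by an expensive high-resolution PDE solver with fixed mesh parameter $\Delta$). For a measurable map $f:Y\to\mathbb{R}$, the push-forward $f\#\mu$ is the probability measure on $\mathbb{R}$ with $\int_{\mathbb{R}}h\,d(f\#\mu)=\int_Y h(f(y))\,d\mu(y)$. All measures involved are assumed to have finite first moment. **Wasserstein metric.** $W_1(\nu,\sigma)=\inf_{\pi\in\Pi(\nu,\sigma)}\int_{\mathbb{R}\times\mathbb{R}}|u-v|\,d\pi(u,v)$, where $\Pi(\nu,\sigma)$ is the set of probability measures on $\mathbb{R}^2$ with first marginal $\nu$ and second marginal $\sigma$. **Baseline QMC algorithm.** Given a low-discrepancy sequence $(y_j)_{j\ge1}$ in $Y$ (e.g. Sobol or Halton), evaluate $\mathcal{L}^{\Delta}$ at the first $J_q$ points and output $\frac1{J_q}\sum_{j=1}^{J_q}\delta_{\mathcal{L}^{\Delta}(y_j)}$. Its cost is the cost of $J_q$ evaluations of $\mathcal{L}^{\Delta}$, i.e. $\mathcal{C}J_q$. **DLQMC algorithm.** Take the first $J_L$ points of the low-discrepancy sequence; for some $N\ll J_L$ evaluate $\mathcal{L}^{\Delta}$ at the first $N$ of them (the training set); from these training data compute a neural network $\mathcal{L}^{\ast}:Y\to\mathbb{R}$; output $\hat\mu^{\ast}_{qmc}=\frac1{J_L}\sum_{j=1}^{J_L}\delta_{\mathcal{L}^{\ast}(y_j)}$.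 Its cost is counted as the cost of $N$ evaluations of $\mathcal{L}^{\Delta}$ plus $J_L$ evaluations of $\mathcal{L}^{\ast}$, i.e. $\mathcal{C}N+\mathcal{C}_{\ast}J_L$ (the cost of training the network is not counted). **Conventions.** $A\sim B$ means that $A$ and $B$ agree up to multiplicative constants: $c_1B\le A\le c_2B$ with constants $0<c_1\le c_2$ independent of $\epsilon$, of the numbers of points ($J$, $J_q$, $J_L$, $N$), of the costs $\mathcal{C},\mathcal{C}_\ast$ and of $V^\Delta,V^\ast$. $A=\mathcal{O}(\epsilon)$ means $A\le c\,\epsilon$ with $c$ likewise independent of these quantities. *)

theory Defs
  imports "HOL-Probability.Probability"
begin

section \<open>Asymptotic comparison with uniform constants\<close>

text \<open>
  The index \<open>x\<close> ranges over all quantities that the constants must not depend on.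
\<close>

definition comparable_on :: "'x set \<Rightarrow> ('x \<Rightarrow> real) \<Rightarrow> ('x \<Rightarrow> real) \<Rightarrow> bool" where
  "comparable_on X A B \<longleftrightarrow>
     (\<exists>c1 c2. 0 < c1 \<and> c1 \<le> c2 \<and> (\<forall>x\<in>X. c1 * B x \<le> A x \<and> A x \<le> c2 * B x))"

definition bigO_on :: "'x set \<Rightarrow> ('x \<Rightarrow> real) \<Rightarrow> ('x \<Rightarrow> real) \<Rightarrow> bool" where
  "bigO_on X A B \<longleftrightarrow> (\<exists>c. \<forall>x\<in>X. A x \<le> c * B x)"


section \<open>Parameter space and push-forward measures\<close>

definition Y :: "(real ^ 'd) set" where
  "Y = {y. \<forall>i. 0 \<le> y $ i \<and> y $ i \<le> 1}"

definition \<mu> :: "(real ^ 'd) measure" where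
  "\<mu> = lebesgue_on Y"

definition push_forward :: "(real ^ 'd \<Rightarrow> real) \<Rightarrow> real measure" where
  "push_forward f = distr \<mu> borel f"

definition finite_first_moment :: "real measure \<Rightarrow> bool" where
  "finite_first_moment \<nu> \<longleftrightarrow> integrable \<nu> (\<lambda>u. \<bar>u\<bar>)"

text \<open>
  The \<open>L\<^sup>p\<close> distance, with value \<open>\<infinity>\<close> if the integral diverges.  The case distinction on
  the integral is there because \<open>powr\<close> is only available on the reals.
\<close>

definition Lp_dist ::
  "ennreal \<Rightarrow> (real ^ 'd \<Rightarrow> real) \<Rightarrow> (real ^ 'd \<Rightarrow> real) \<Rightarrow> ennreal" where
  "Lp_dist p f g =
     (if p = \<infinity> then esssup \<mu> (\<lambda>y. ennreal \<bar>f y - g y\<bar>)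
      else let r = enn2real p;
               I = (\<integral>\<^sup>+ y. ennreal (\<bar>f y - g y\<bar> powr r) \<partial>\<mu>)
           in if I = \<infinity> then \<infinity> else ennreal (enn2real I powr (1 / r)))"


section \<open>The 1-Wasserstein metric\<close>

definition couplings :: "real measure \<Rightarrow> real measure \<Rightarrow> (real \<times> real) measure set" where
  "couplings \<nu> \<sigma> = {\<pi>. prob_space \<pi> \<and> sets \<pi> = sets borel \<and>
                       distr \<pi> borel fst = \<nu> \<and> distr \<pi> borel snd = \<sigma>}"

text \<open>
  To be used for probability measures with finite first moment only: then the integrand is
  integrable with respect to every coupling and the infimum is over a nonempty set.
\<close>

definition W1 :: "real measure \<Rightarrow> real measure \<Rightarrow> real" where
  "W1 \<nu> \<sigma> = (INF \<pi>\<in>couplings \<nu> \<sigma>. \<integral>z. \<bar>fst z - snd z\<bar> \<partial>\<pi>)"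


section \<open>Low-discrepancy sequences\<close>

text \<open>
  Sequences are indexed from \<open>0\<close>, so the first \<open>J\<close> points are \<open>y 0, \<dots>, y (J - 1)\<close>.
\<close>

definition star_discrepancy :: "(nat \<Rightarrow> real ^ 'd) \<Rightarrow> nat \<Rightarrow> real" where
  "star_discrepancy y J =
     (SUP x\<in>Y. \<bar>real (card {j. j < J \<and> (\<forall>i. 0 \<le> y j $ i \<and> y j $ i < x $ i)}) / real J
                 - (\<Prod>i\<in>UNIV. x $ i)\<bar>)"

definition low_discrepancy :: "(nat \<Rightarrow> real ^ 'd) \<Rightarrow> bool" where
  "low_discrepancy y \<longleftrightarrow>
     (\<forall>j. y j \<in> Y) \<and>
     (\<exists>c. \<forall>J\<ge>2. star_discrepancy y J \<le> c * ln (real J) ^ CARD('d) / real J)"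


section \<open>The QMC and DLQMC algorithms\<close>

definition empirical_measure ::
  "(nat \<Rightarrow> real ^ 'd) \<Rightarrow> (real ^ 'd \<Rightarrow> real) \<Rightarrow> nat \<Rightarrow> real measure" where
  "empirical_measure y f J = distr (uniform_count_measure {..<J}) borel (\<lambda>j. f (y j))"

lemma emeasure_empirical_measure:
  fixes f :: "real ^ 'd \<Rightarrow> real"
  assumes "0 < J" and "A \<in> sets borel"
  shows "emeasure (empirical_measure y f J) A =
           ennreal (1 / real J) * (\<Sum>j<J. emeasure (return borel (f (y j))) A)"
proof -
  have "emeasure (empirical_measure y f J) A =
          emeasure (uniform_count_measure {..<J}) ((\<lambda>j. f (y j)) -` A \<inter> {..<J})"
    using assms
    by (simp add: empirical_measure_def emeasure_distr space_uniform_count_measure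
        measurable_def sets_uniform_count_measure)
  also have "\<dots> = ennreal (real (card ((\<lambda>j. f (y j)) -` A \<inter> {..<J})) / real J)"
    by (simp add: emeasure_uniform_count_measure)
  also have "\<dots> = ennreal (1 / real J) * of_nat (card ((\<lambda>j. f (y j)) -` A \<inter> {..<J}))"
    by (simp add: ennreal_of_nat_eq_real_of_nat flip: ennreal_mult)
  also have "of_nat (card ((\<lambda>j. f (y j)) -` A \<inter> {..<J})) =
               (\<Sum>j<J. emeasure (return borel (f (y j))) A)"
    using assms
    by (simp add: indicator_def sum.If_cases Int_def vimage_def conj_commute)
  finally show ?thesis .
qed

definition training_data ::
  "(nat \<Rightarrow> real ^ 'd) \<Rightarrow> (real ^ 'd \<Rightarrow> real) \<Rightarrow> nat \<Rightarrow> ((real ^ 'd) \<times> real) list" where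
  "training_data y L N = map (\<lambda>j. (y j, L (y j))) [0..<N]"

text \<open>
  A network architecture is given by its realization map \<open>net\<close> from weights to functions; neither
  the architecture nor the training procedure, which selects weights from data, is restricted.
\<close>

definition trained_network ::
  "('w \<Rightarrow> real ^ 'd \<Rightarrow> real) \<Rightarrow> (((real ^ 'd) \<times> real) list \<Rightarrow> 'w) \<Rightarrow>
   (nat \<Rightarrow> real ^ 'd) \<Rightarrow> (real ^ 'd \<Rightarrow> real) \<Rightarrow> nat \<Rightarrow> (real ^ 'd \<Rightarrow> real)" where
  "trained_network net train y L N = net (train (training_data y L N))"

definition qmc_cost :: "real \<Rightarrow> nat \<Rightarrow> real" where
  "qmc_cost C Jq = C * real Jq"

text \<open>The cost of training the network is not counted.\<close>

definition dlqmc_cost :: "real \<Rightarrow> real \<Rightarrow> nat \<Rightarrow> nat \<Rightarrow> real" where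
  "dlqmc_cost C Cs N JL = C * real N + Cs * real JL"

definition dlqmc_speedup :: "real \<Rightarrow> real \<Rightarrow> nat \<Rightarrow> nat \<Rightarrow> nat \<Rightarrow> real" where
  "dlqmc_speedup C Cs N Jq JL = qmc_cost C Jq / dlqmc_cost C Cs N JL"

end

theory Submission
  imports Defs
begin

text \<open>
  The error bound for the surrogate is the triangle inequality for \<open>W1\<close>.  Instead of
  disintegrating measures, one uses that the empirical measure \<open>\<sigma>\<close> is purely atomic: a coupling
  of \<open>X'#P\<close> and \<open>\<sigma>\<close> then has a density \<open>h\<close> with respect to the product measure, and
  \<open>h (X' w, z)\<close> is a density with respect to \<open>P \<otimes> \<sigma>\<close> whose image under \<open>(X w, z)\<close> couples \<open>X#P\<close>
  and \<open>\<sigma>\<close> at an extra cost of at most \<open>E \<bar>X - X'\<bar>\<close>.  By Jensen's inequality the latter is at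
  most the \<open>L\<^sup>p\<close> distance.  The speedup formula is arithmetic:
  \<open>1 / \<Sigma> = N / Jq + (Cs / C) (JL / Jq)\<close>.
\<close>

section \<open>Couplings with a purely atomic second marginal\<close>

text \<open>Over \<nu>-almost every point a product-null set has a \<sigma>-null section, and a
  \<sigma>-null set contains no atom. The section therefore misses all of \<open>Z\<close>, which
  carries the second marginal of \<pi>.\<close>

lemma coupling_absolutely_continuous:
  assumes \<pi>: "\<pi> \<in> couplings \<nu> \<sigma>" and "prob_space \<nu>" "prob_space \<sigma>"
    and Z: "countable Z" "AE z in \<sigma>. z \<in> Z" "\<And>z. z \<in> Z \<Longrightarrow> emeasure \<sigma> {z} \<noteq> 0"
  shows "absolutely_continuous (\<nu> \<Otimes>\<^sub>M \<sigma>) \<pi>"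
  unfolding absolutely_continuous_def
proof
  interpret \<nu>: prob_space \<nu> by fact
  interpret \<sigma>: prob_space \<sigma> by fact
  interpret pair_sigma_finite \<nu> \<sigma> ..
  have setsp: "sets \<pi> = sets borel" and fst: "distr \<pi> borel fst = \<nu>" and snd: "distr \<pi> borel snd = \<sigma>"
    using \<pi> by (auto simp: couplings_def)
  have sets\<nu>: "sets \<nu> = sets borel" and sets\<sigma>: "sets \<sigma> = sets borel"
    using fst snd by auto
  have mf: "fst \<in> \<pi> \<rightarrow>\<^sub>M (borel :: real measure)" and ms: "snd \<in> \<pi> \<rightarrow>\<^sub>M (borel :: real measure)"
    by (simp_all add: measurable_cong_sets[OF setsp refl] flip: borel_prod)
  fix A assume A: "A \<in> null_sets (\<nu> \<Otimes>\<^sub>M \<sigma>)"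
  have "AE w in \<nu> \<Otimes>\<^sub>M \<sigma>. w \<notin> A" using A by (rule AE_not_in)
  then have "AE x in \<nu>. AE z in \<sigma>. (x, z) \<notin> A" by (rule AE_pair)
  then have "AE x in \<nu>. \<forall>z\<in>Z. (x, z) \<notin> A"
  proof (rule AE_mp, intro AE_I2 impI ballI)
    fix x z assume AE: "AE z in \<sigma>. (x, z) \<notin> A" and "z \<in> Z"
    from AE obtain M where M: "{z \<in> space \<sigma>. \<not> (x, z) \<notin> A} \<subseteq> M" "emeasure \<sigma> M = 0" "M \<in> sets \<sigma>"
      by (rule AE_E)
    show "(x, z) \<notin> A"
    proof
      assume "(x, z) \<in> A"
      then have "{z} \<subseteq> M" using M sets_eq_imp_space_eq[OF sets\<sigma>] by auto
      then have "emeasure \<sigma> {z} \<le> emeasure \<sigma> M" using M by (intro emeasure_mono) auto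
      then show False using M Z(3)[OF \<open>z \<in> Z\<close>] by simp
    qed
  qed
  \<comment> \<open>This statement and the next one each restrict a single coordinate, so they pass
    from the marginals to \<pi> whatever the dependence between the coordinates.\<close>
  then have "AE w in \<pi>. \<forall>z\<in>Z. (fst w, z) \<notin> A"
    unfolding fst[symmetric] by (rule AE_distrD[OF mf])
  moreover have "AE w in \<pi>. snd w \<in> Z"
    using Z(2) unfolding snd[symmetric] by (rule AE_distrD[OF ms])
  ultimately have "AE w in \<pi>. w \<notin> A" by eventually_elim auto
  moreover have "sets (\<nu> \<Otimes>\<^sub>M \<sigma>) = sets \<pi>"
    using sets_pair_measure_cong[OF sets\<nu> sets\<sigma>] by (simp only: borel_prod setsp)
  then have "A \<in> sets \<pi>" using A by auto
  ultimately show "A \<in> null_sets \<pi>"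
    by (subst (asm) AE_iff_null_sets[symmetric]) auto
qed

text \<open>A gluing lemma: the coupling is lifted from the image of \<open>X\<close> to the space
  of \<open>P\<close> itself, so that a second function on that space can later be evaluated under
  the same \<open>Q\<close>.\<close>

lemma glue_coupling:
  fixes X :: "'a \<Rightarrow> real"
  assumes "prob_space P" and X [measurable]: "X \<in> borel_measurable P"
    and \<pi>: "\<pi> \<in> couplings (distr P borel X) \<sigma>" and "prob_space \<sigma>"
    and Z: "countable Z" "AE z in \<sigma>. z \<in> Z" "\<And>z. z \<in> Z \<Longrightarrow> emeasure \<sigma> {z} \<noteq> 0"
  obtains Q where "prob_space Q" "sets Q = sets (P \<Otimes>\<^sub>M borel)" "distr Q P fst = P"
    "distr Q borel (\<lambda>(w, z). (X w, z)) = \<pi>"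
proof -
  interpret P: prob_space P by fact
  interpret \<sigma>: prob_space \<sigma> by fact
  define \<nu> where "\<nu> = distr P borel X"
  interpret \<nu>: prob_space \<nu> unfolding \<nu>_def by (rule P.prob_space_distr) simp
  interpret \<nu>\<sigma>: pair_prob_space \<nu> \<sigma> ..
  have \<pi>': "\<pi> \<in> couplings \<nu> \<sigma>" using \<pi> by (simp add: \<nu>_def)
  have setsp: "sets \<pi> = sets borel" and fst: "distr \<pi> borel fst = \<nu>" and snd: "distr \<pi> borel snd = \<sigma>"
    and "prob_space \<pi>"
    using \<pi>' by (auto simp: couplings_def)
  interpret \<pi>: prob_space \<pi> by fact
  have sets\<nu> [measurable_cong]: "sets \<nu> = sets borel" and sets\<sigma> [measurable_cong]: "sets \<sigma> = sets borel"
    using fst snd by auto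
  have setsprod: "sets (\<nu> \<Otimes>\<^sub>M \<sigma>) = sets borel"
    using sets_pair_measure_cong[OF sets\<nu> sets\<sigma>] by (simp only: borel_prod)
  obtain h where h [measurable]: "h \<in> borel_measurable (\<nu> \<Otimes>\<^sub>M \<sigma>)" and h\<pi>: "density (\<nu> \<Otimes>\<^sub>M \<sigma>) h = \<pi>"
    using \<nu>\<sigma>.P.Radon_Nikodym[OF coupling_absolutely_continuous[OF \<pi>' \<nu>.prob_space_axioms
        \<sigma>.prob_space_axioms Z]] setsp setsprod by auto
  define Q where "Q = density (P \<Otimes>\<^sub>M \<sigma>) (\<lambda>w. h (X (fst w), snd w))"
  have hX [measurable]: "(\<lambda>w. h (X (fst w), snd w)) \<in> borel_measurable (P \<Otimes>\<^sub>M \<sigma>)"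
    by (rule measurable_compose[OF _ h]) measurable
  \<comment> \<open>Writing \<sigma> as its own image under the identity makes the product of images
    an image of the product; \<open>X\<close> acts on the first factor only.\<close>
  have "distr P borel X \<Otimes>\<^sub>M distr \<sigma> \<sigma> (\<lambda>z. z) = distr (P \<Otimes>\<^sub>M \<sigma>) (borel \<Otimes>\<^sub>M \<sigma>) (\<lambda>(x, y). (X x, y))"
    by (rule pair_measure_distr) (auto simp: distr_id \<sigma>.sigma_finite_measure_axioms)
  then have prod: "\<nu> \<Otimes>\<^sub>M \<sigma> = distr (P \<Otimes>\<^sub>M \<sigma>) (\<nu> \<Otimes>\<^sub>M \<sigma>) (\<lambda>w. (X (fst w), snd w))"
    by (simp add: distr_id \<nu>_def case_prod_beta' cong: distr_cong sets_pair_measure_cong)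
  \<comment> \<open>The density of \<open>Q\<close> is the pullback of \<open>h\<close>, so the
    image of \<open>Q\<close> has density \<open>h\<close> with respect to the image of the
    product.\<close>
  have Q\<pi>': "distr Q (\<nu> \<Otimes>\<^sub>M \<sigma>) (\<lambda>w. (X (fst w), snd w)) = \<pi>"
    unfolding h\<pi>[symmetric] Q_def
    by (subst density_distr[symmetric, of h "\<nu> \<Otimes>\<^sub>M \<sigma>"]) (auto simp flip: prod)
  have mX: "(\<lambda>w. (X (fst w), snd w)) \<in> Q \<rightarrow>\<^sub>M \<nu> \<Otimes>\<^sub>M \<sigma>" by (simp add: Q_def)
  have Q: "prob_space Q"
    using \<pi>.prob_space_axioms mX unfolding Q\<pi>'[symmetric]
    by (rule prob_space_distrD[rotated])
  interpret Q: prob_space Q by fact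
  \<comment> \<open>Integrating out \<open>z\<close> gives the density of the first marginal of
    \<pi> with respect to \<nu>. That marginal is \<nu>, whose density is 1. Pulled back along
    \<open>X\<close>, this makes the first marginal of \<open>Q\<close> equal to
    \<open>P\<close>.\<close>
  have "AE x in \<nu>. (1 :: ennreal) = (\<integral>\<^sup>+z. h (x, z) \<partial>\<sigma>)"
  proof (rule \<pi>.distributed_marginal_eq_joint1[where X = fst and Y = snd])
    have m: "id \<in> \<pi> \<rightarrow>\<^sub>M \<nu> \<Otimes>\<^sub>M \<sigma>" using h\<pi> by auto
    have m': "fst \<in> \<pi> \<rightarrow>\<^sub>M \<nu>" using measurable_compose[OF m measurable_fst] by simp
    have "distr \<pi> \<nu> fst = \<nu>" using fst sets\<nu> by (metis distr_cong)
    then show "distributed \<pi> \<nu> fst (\<lambda>_. 1)"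
      using m' by (simp add: distributed_def density_1)
    have "distr \<pi> (\<nu> \<Otimes>\<^sub>M \<sigma>) (\<lambda>x. x) = \<pi>"
      using setsp setsprod by (intro distr_id2) simp
    then show "distributed \<pi> (\<nu> \<Otimes>\<^sub>M \<sigma>) (\<lambda>x. (fst x, snd x)) h"
      using m h h\<pi> by (simp add: distributed_def id_def)
  qed (fact \<sigma>.sigma_finite_measure_axioms \<nu>.sigma_finite_measure_axioms)+
  then have AE: "AE w in P. (1 :: ennreal) = (\<integral>\<^sup>+z. h (X w, z) \<partial>\<sigma>)"
    unfolding \<nu>_def by (rule AE_distrD[OF X])
  have "distributed Q P fst (\<lambda>w. \<integral>\<^sup>+z. h (X (fst (w, z)), snd (w, z)) \<partial>\<sigma>)"
    by (rule Q.distr_marginal1[where Y = snd])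
      (auto simp: distributed_def Q_def P.sigma_finite_measure_axioms \<sigma>.sigma_finite_measure_axioms
        intro!: distr_id2)
  then have "distr Q P fst = density P (\<lambda>w. \<integral>\<^sup>+z. h (X w, z) \<partial>\<sigma>)"
    by (simp add: distributed_def)
  also have "\<dots> = density P (\<lambda>_. 1)"
    using AE by (intro density_cong) auto
  finally have Q1: "distr Q P fst = P" by (simp add: density_1)
  have "distr Q borel (\<lambda>(w, z). (X w, z)) = \<pi>"
    unfolding Q\<pi>'[symmetric] by (rule distr_cong) (auto simp: setsprod)
  moreover have "sets Q = sets (P \<Otimes>\<^sub>M borel)"
    by (simp add: Q_def sets\<sigma> cong: sets_pair_measure_cong)
  ultimately show thesis using that Q Q1 by blast
qed

section \<open>Wasserstein distance and the triangle inequality\<close>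

lemma W1_le:
  assumes "\<pi> \<in> couplings \<nu> \<sigma>"
  shows "W1 \<nu> \<sigma> \<le> (\<integral>z. \<bar>fst z - snd z\<bar> \<partial>\<pi>)"
  unfolding W1_def using assms by (intro cINF_lower bdd_belowI2[of _ 0]) auto

text \<open>The product measure is a coupling. Nonemptiness is what lets a lower bound on all costs
  pass to the real-valued infimum in \<open>W1\<close>.\<close>

lemma couplings_nonempty:
  assumes "prob_space \<nu>" "prob_space \<sigma>" "sets \<nu> = sets borel" "sets \<sigma> = sets borel"
  shows "couplings \<nu> \<sigma> \<noteq> {}"
proof -
  interpret \<nu>: prob_space \<nu> by fact
  interpret \<sigma>: prob_space \<sigma> by fact
  interpret pair_prob_space \<nu> \<sigma> ..
  have "sets (\<nu> \<Otimes>\<^sub>M \<sigma>) = sets borel"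
    using sets_pair_measure_cong[OF assms(3,4)] by (simp only: borel_prod)
  moreover have "distr (\<nu> \<Otimes>\<^sub>M \<sigma>) borel fst = \<nu>"
    using \<sigma>.distr_pair_fst[of \<nu>] assms(3) by (metis distr_cong)
  moreover have "distr (\<nu> \<Otimes>\<^sub>M \<sigma>) borel snd = \<sigma>"
  proof (rule measure_eqI)
    fix A assume "A \<in> sets (distr (\<nu> \<Otimes>\<^sub>M \<sigma>) borel snd)"
    then have A: "A \<in> sets \<sigma>" using assms(4) by simp
    have "emeasure (distr (\<nu> \<Otimes>\<^sub>M \<sigma>) borel snd) A = emeasure (\<nu> \<Otimes>\<^sub>M \<sigma>) (space \<nu> \<times> A)"
      using A assms(4) sets.sets_into_space[OF A]
      by (subst emeasure_distr)
        (auto simp: space_pair_measure measurable_cong_sets[OF refl assms(4)[symmetric]]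
          intro!: arg_cong2[where f = emeasure])
    also have "\<dots> = emeasure \<sigma> A" using A by (simp add: \<sigma>.emeasure_pair_measure_Times \<nu>.emeasure_space_1)
    finally show "emeasure (distr (\<nu> \<Otimes>\<^sub>M \<sigma>) borel snd) A = emeasure \<sigma> A" .
  qed (simp add: assms)
  ultimately have "\<nu> \<Otimes>\<^sub>M \<sigma> \<in> couplings \<nu> \<sigma>"
    by (auto simp: couplings_def P.prob_space_axioms)
  then show ?thesis by auto
qed

text \<open>A triangle inequality through \<open>distr P borel X'\<close>, with the first leg
  already bounded by the cost of moving \<open>X\<close> to \<open>X'\<close> on their common space
  \<open>P\<close>.\<close>

lemma W1_distr_le:
  fixes X X' :: "'a \<Rightarrow> real"
  assumes "prob_space P" and X: "integrable P X" and X': "integrable P X'"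
    and "prob_space \<sigma>" and sets\<sigma>: "sets \<sigma> = sets borel" and \<sigma>1: "integrable \<sigma> (\<lambda>z. z)"
    and Z: "countable Z" "AE z in \<sigma>. z \<in> Z" "\<And>z. z \<in> Z \<Longrightarrow> emeasure \<sigma> {z} \<noteq> 0"
  shows "W1 (distr P borel X) \<sigma> \<le> (\<integral>w. \<bar>X w - X' w\<bar> \<partial>P) + W1 (distr P borel X') \<sigma>"
proof -
  interpret P: prob_space P by fact
  have [measurable]: "fst \<in> borel_measurable (borel :: (real \<times> real) measure)"
    "snd \<in> borel_measurable (borel :: (real \<times> real) measure)"
    by (simp_all flip: borel_prod)
  have [measurable]: "X \<in> borel_measurable P" "X' \<in> borel_measurable P" using X X' by auto
  \<comment> \<open>With the fixed cost moved to the left, the claim is a lower bound for an infimum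
    and can be checked on one coupling at a time.\<close>
  have "W1 (distr P borel X) \<sigma> - (\<integral>w. \<bar>X w - X' w\<bar> \<partial>P) \<le> W1 (distr P borel X') \<sigma>"
    unfolding W1_def[of "distr P borel X'"]
  proof (rule cINF_greatest)
    show "couplings (distr P borel X') \<sigma> \<noteq> {}"
      by (intro couplings_nonempty P.prob_space_distr) (simp_all add: assms)
    fix \<pi> assume \<pi>: "\<pi> \<in> couplings (distr P borel X') \<sigma>"
    obtain Q where "prob_space Q" and setsQ [measurable_cong]: "sets Q = sets (P \<Otimes>\<^sub>M borel)"
      and QP: "distr Q P fst = P" and Q\<pi>: "distr Q borel (\<lambda>(w, z). (X' w, z)) = \<pi>"
      using glue_coupling[OF P.prob_space_axioms _ \<pi> \<open>prob_space \<sigma>\<close> Z] by auto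
    interpret Q: prob_space Q by fact
    have mQ [measurable]: "(\<lambda>w. (X' (fst w), snd w)) \<in> borel_measurable Q"
      "(\<lambda>w. (X (fst w), snd w)) \<in> borel_measurable Q"
      unfolding borel_prod[symmetric] by measurable
    have "distr \<pi> borel snd = \<sigma>" using \<pi> by (simp add: couplings_def)
    then have Q\<sigma>: "distr Q borel snd = \<sigma>"
      unfolding Q\<pi>[symmetric] case_prod_beta' by (subst (asm) distr_distr) (auto simp: comp_def)
    \<comment> \<open>The marginals of \<open>Q\<close> are \<open>P\<close> and \<sigma>, so the
      first moments carry over; the Bochner integrals below can then be split.\<close>
    have int: "integrable Q (\<lambda>w. X (fst w))" "integrable Q (\<lambda>w. X' (fst w))" "integrable Q snd"
      using integrable_distr[of fst Q P X] integrable_distr[of fst Q P X']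
        integrable_distr[of snd Q borel "\<lambda>z. z"] X X' \<sigma>1 QP Q\<sigma> by (auto simp: id_def)
    \<comment> \<open>The competitor: under \<open>Q\<close> the second coordinate stays, while
      \<open>X\<close> takes the place of \<open>X'\<close>.\<close>
    define \<pi>' where "\<pi>' = distr Q borel (\<lambda>w. (X (fst w), snd w))"
    have "distr \<pi>' borel fst = distr (distr Q P fst) borel X" "distr \<pi>' borel snd = \<sigma>"
      unfolding \<pi>'_def by (auto simp: distr_distr comp_def Q\<sigma>)
    then have "\<pi>' \<in> couplings (distr P borel X) \<sigma>"
      by (auto simp: couplings_def QP \<pi>'_def intro!: Q.prob_space_distr)
    then have "W1 (distr P borel X) \<sigma> \<le> (\<integral>z. \<bar>fst z - snd z\<bar> \<partial>\<pi>')" by (rule W1_le)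
    also have "\<dots> = (\<integral>w. \<bar>X (fst w) - snd w\<bar> \<partial>Q)"
      unfolding \<pi>'_def by (subst integral_distr) auto
    also have "\<dots> \<le> (\<integral>w. \<bar>X (fst w) - X' (fst w)\<bar> + \<bar>X' (fst w) - snd w\<bar> \<partial>Q)"
      using int by (intro integral_mono) auto
    also have "\<dots> = (\<integral>w. \<bar>X (fst w) - X' (fst w)\<bar> \<partial>Q) + (\<integral>w. \<bar>X' (fst w) - snd w\<bar> \<partial>Q)"
      using int by (intro Bochner_Integration.integral_add) auto
    also have "(\<integral>w. \<bar>X (fst w) - X' (fst w)\<bar> \<partial>Q) = (\<integral>w. \<bar>X w - X' w\<bar> \<partial>distr Q P fst)"
      by (subst integral_distr) auto
    also have "(\<integral>w. \<bar>X' (fst w) - snd w\<bar> \<partial>Q) = (\<integral>z. \<bar>fst z - snd z\<bar> \<partial>\<pi>)"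
      unfolding Q\<pi>[symmetric] case_prod_beta' by (subst integral_distr) auto
    finally show "W1 (distr P borel X) \<sigma> - (\<integral>w. \<bar>X w - X' w\<bar> \<partial>P) \<le> (\<integral>z. \<bar>fst z - snd z\<bar> \<partial>\<pi>)"
      by (simp add: QP)
  qed
  then show ?thesis by simp
qed

section \<open>The unit cube and the comparison of \<open>L\<^sup>1\<close> with
  \<open>L\<^sup>p\<close>\<close>

lemma prob_space_\<mu>: "prob_space (\<mu> :: (real ^ 'd) measure)"
proof
  have Y: "(Y :: (real ^ 'd) set) = cbox 0 1"
    by (auto simp: Y_def mem_box_cart)
  have "emeasure lborel (cbox 0 (1 :: real ^ 'd)) = (\<Prod>b\<in>Basis. (1 - 0 :: real ^ 'd) \<bullet> b)"
    by (intro emeasure_lborel_cbox) (auto simp: Basis_vec_def inner_axis)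
  also have "\<dots> = 1"
    by (auto simp: Basis_vec_def inner_axis intro!: prod.neutral)
  finally show "emeasure (\<mu> :: (real ^ 'd) measure) (space \<mu>) = 1"
    by (simp add: \<mu>_def Y emeasure_restrict_space space_restrict_space)
qed

text \<open>
  The tangent line of \<open>t \<mapsto> t powr r\<close> at \<open>B\<close>, solved for \<open>t\<close>; integrating it yields Jensen's
  inequality without an integrability assumption.
\<close>

lemma le_powr_mean:
  fixes t B r :: real
  assumes "0 \<le> t" "0 < B" "1 \<le> r"
  shows "t \<le> B powr (1 - r) / r * t powr r + (1 - 1 / r) * B"
proof (cases "t = 0")
  case False
  then have t: "0 < t" using assms by simp
  \<comment> \<open>Young's inequality with weights \<open>1 / r\<close> and
    \<open>1 - 1 / r\<close>, for positive bases. Multiplying by \<open>B powr (1 - r)\<close>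
    afterwards isolates \<open>t\<close>.\<close>
  have "(t powr r) powr (1 / r) * (B powr r) powr (1 - 1 / r) \<le> 1 / r * t powr r + (1 - 1 / r) * B powr r"
    using assms t by (intro Youngs_inequality_0) auto
  then have "t * B powr (r - 1) \<le> 1 / r * t powr r + (1 - 1 / r) * B powr r"
    using assms t by (simp add: powr_powr algebra_simps)
  then have "t * B powr (r - 1) * B powr (1 - r) \<le> (1 / r * t powr r + (1 - 1 / r) * B powr r) * B powr (1 - r)"
    by (rule mult_right_mono) simp
  moreover have "B powr (r - 1) * B powr (1 - r) = 1" "B powr r * B powr (1 - r) = B"
    using assms by (simp_all flip: powr_add)
  ultimately show ?thesis by (simp add: algebra_simps)
qed (use assms in auto)

text \<open>Since the total mass is 1, integrating \<open>le_powr_mean\<close> gives at most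
  \<open>B / r + (1 - 1 / r) * B\<close>, which is \<open>B\<close>.\<close>

lemma nn_integral_le_powr_mean:
  assumes "prob_space M" and [measurable]: "f \<in> borel_measurable M" and "\<And>x. 0 \<le> f x"
    and B: "0 < B" and r: "1 \<le> r" and I: "(\<integral>\<^sup>+x. ennreal (f x powr r) \<partial>M) \<le> ennreal (B powr r)"
  shows "(\<integral>\<^sup>+x. ennreal (f x) \<partial>M) \<le> ennreal B"
proof -
  interpret prob_space M by fact
  let ?k = "B powr (1 - r) / r" and ?m = "(1 - 1 / r) * B"
  have k: "0 \<le> ?k" "0 \<le> ?m" using B r by auto
  have "(\<integral>\<^sup>+x. ennreal (f x) \<partial>M) \<le> (\<integral>\<^sup>+x. ennreal ?k * ennreal (f x powr r) + ennreal ?m \<partial>M)"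
  proof (rule nn_integral_mono)
    fix x
    have "ennreal (f x) \<le> ennreal (?k * f x powr r + ?m)"
      by (intro ennreal_leI le_powr_mean assms)
    also have "\<dots> = ennreal ?k * ennreal (f x powr r) + ennreal ?m"
      using k by (simp only: ennreal_mult ennreal_plus powr_ge_zero mult_nonneg_nonneg)
    finally show "ennreal (f x) \<le> ennreal ?k * ennreal (f x powr r) + ennreal ?m" .
  qed
  also have "\<dots> = ennreal ?k * (\<integral>\<^sup>+x. ennreal (f x powr r) \<partial>M) + ennreal ?m"
    by (simp add: nn_integral_add nn_integral_cmult emeasure_space_1)
  also have "\<dots> \<le> ennreal ?k * ennreal (B powr r) + ennreal ?m"
    using I by (intro add_mono mult_left_mono) auto
  also have "\<dots> = ennreal (?k * B powr r + ?m)"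
    using k by (simp only: ennreal_mult ennreal_plus powr_ge_zero mult_nonneg_nonneg)
  also have "?k * B powr r = B / r"
    using B by (simp flip: powr_add)
  also have "B / r + ?m = B" by (simp add: algebra_simps)
  finally show ?thesis .
qed

text \<open>On a probability space the \<open>L\<^sup>1\<close> distance is at most the
  \<open>L\<^sup>p\<close> distance: an almost sure bound is integrated for infinite
  \<open>p\<close>, and Jensen's inequality is used for finite \<open>p\<close>.\<close>

lemma nn_integral_le_Lp_dist:
  fixes f g :: "real ^ 'd \<Rightarrow> real"
  assumes [measurable]: "f \<in> borel_measurable \<mu>" "g \<in> borel_measurable \<mu>"
    and p: "1 \<le> p" and B: "0 < B" and le: "Lp_dist p f g \<le> ennreal B"
  shows "(\<integral>\<^sup>+y. ennreal \<bar>f y - g y\<bar> \<partial>\<mu>) \<le> ennreal B"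
proof (cases "p = \<infinity>")
  case True
  interpret prob_space "\<mu> :: (real ^ 'd) measure" by (rule prob_space_\<mu>)
  have "AE y in \<mu>. ennreal \<bar>f y - g y\<bar> \<le> esssup \<mu> (\<lambda>y. ennreal \<bar>f y - g y\<bar>)"
    by (rule esssup_AE)
  then have "AE y in \<mu>. ennreal \<bar>f y - g y\<bar> \<le> ennreal B"
    by eventually_elim (use le True in \<open>auto simp: Lp_dist_def\<close>)
  then have "(\<integral>\<^sup>+y. ennreal \<bar>f y - g y\<bar> \<partial>\<mu>) \<le> (\<integral>\<^sup>+(y :: real ^ 'd). ennreal B \<partial>\<mu>)"
    by (rule nn_integral_mono_AE)
  then show ?thesis by (simp add: emeasure_space_1)
next
  case False
  define r where "r = enn2real p"
  define I where "I = (\<integral>\<^sup>+ y. ennreal (\<bar>f y - g y\<bar> powr r) \<partial>\<mu>)"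
  have r: "1 \<le> r" using p False unfolding r_def by (cases p) auto
  \<comment> \<open>A finite bound on \<open>Lp_dist\<close> excludes the branch of a divergent
    integral, so \<open>enn2real\<close> loses nothing.\<close>
  have I: "I \<noteq> \<infinity>" "enn2real I powr (1 / r) \<le> B"
    using le False B by (auto simp: Lp_dist_def I_def r_def Let_def top_unique split: if_splits)
  have "(enn2real I powr (1 / r)) powr r \<le> B powr r"
    using I r by (intro powr_mono2) auto
  then have "(\<integral>\<^sup>+ y. ennreal (\<bar>f y - g y\<bar> powr r) \<partial>\<mu>) \<le> ennreal (B powr r)"
    unfolding I_def[symmetric]
    using I r by (cases I) (auto simp: powr_powr ennreal_leI)
  from nn_integral_le_powr_mean[OF prob_space_\<mu> _ _ B r this] show ?thesis by simp
qed

section \<open>Empirical measures and the surrogate error\<close>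

context
  fixes y :: "nat \<Rightarrow> real ^ 'd" and f :: "real ^ 'd \<Rightarrow> real" and J :: nat
  assumes J: "0 < J"
begin

lemma prob_space_empirical_measure: "prob_space (empirical_measure y f J)"
  unfolding empirical_measure_def using J
  by (intro prob_space.prob_space_distr prob_space_uniform_count_measure) auto

lemma integrable_empirical_measure: "integrable (empirical_measure y f J) (\<lambda>z. z)"
  unfolding empirical_measure_def
  by (subst integrable_distr_eq)
    (auto simp: uniform_count_measure_def intro!: integrable_point_measure_finite)

lemma AE_empirical_measure: "AE z in empirical_measure y f J. z \<in> (\<lambda>j. f (y j)) ` {..<J}"
  unfolding empirical_measure_def
  by (subst AE_distr_iff) (auto simp: space_uniform_count_measure intro!: borel_closed finite_imp_closed)

text \<open>Each node value has mass at least \<open>1 / J\<close>. Together with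
  \<open>AE_empirical_measure\<close> this makes the finite set of node values a valid
  \<open>Z\<close> for gluing.\<close>

lemma emeasure_empirical_measure_atom:
  "z \<in> (\<lambda>j. f (y j)) ` {..<J} \<Longrightarrow> emeasure (empirical_measure y f J) {z} \<noteq> 0"
  using J by (subst emeasure_empirical_measure) (auto intro!: bexI simp: indicator_def)

text \<open>\<open>W1_distr_le\<close> on the cube, with the empirical measure of \<open>f\<close>
  as the atomic target; the cost of replacing \<open>f\<close> by \<open>g\<close> is their
  \<open>L\<^sup>1\<close> distance.\<close>

lemma W1_push_forward_empirical_le:
  fixes g :: "real ^ 'd \<Rightarrow> real" and B :: real
  assumes [measurable]: "g \<in> borel_measurable \<mu>" "f \<in> borel_measurable \<mu>"
    and "finite_first_moment (push_forward g)" "finite_first_moment (push_forward f)"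
    and p: "1 \<le> p" and B: "0 < B" and le: "Lp_dist p g f \<le> ennreal B"
  shows "W1 (push_forward g) (empirical_measure y f J) \<le> B + W1 (push_forward f) (empirical_measure y f J)"
proof -
  have int: "integrable \<mu> g" "integrable \<mu> f"
    using assms(3,4)
    by (auto simp: finite_first_moment_def push_forward_def integrable_distr_eq intro: integrable_norm_cancel)
  have "ennreal (\<integral>w. \<bar>g w - f w\<bar> \<partial>\<mu>) = (\<integral>\<^sup>+w. ennreal \<bar>g w - f w\<bar> \<partial>\<mu>)"
    using int by (subst nn_integral_eq_integral) auto
  also have "\<dots> \<le> ennreal B"
    using p B le by (intro nn_integral_le_Lp_dist) auto
  finally have "(\<integral>w. \<bar>g w - f w\<bar> \<partial>\<mu>) \<le> B" using B by simp
  moreover have "W1 (push_forward g) (empirical_measure y f J)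
      \<le> (\<integral>w. \<bar>g w - f w\<bar> \<partial>\<mu>) + W1 (push_forward f) (empirical_measure y f J)"
    unfolding push_forward_def
    using int prob_space_empirical_measure integrable_empirical_measure AE_empirical_measure
    by (intro W1_distr_le[where Z = "(\<lambda>j. f (y j)) ` {..<J}"] prob_space_\<mu> emeasure_empirical_measure_atom)
      (auto simp: empirical_measure_def)
  ultimately show ?thesis by simp
qed

end

section \<open>Rates, costs and the calculus of comparability\<close>

text \<open>The exponents \<alpha> and \<open>1 / \<alpha>\<close> cancel: \<open>V / J\<close> is
  at most \<open>e powr (1 / \<alpha>) / b\<close>.\<close>

lemma rate_le_tolerance:
  fixes V e b \<alpha> J :: real
  assumes "0 < V" "0 < e" "0 < \<alpha>" "0 < b" and J: "b * (V * e powr (- 1 / \<alpha>)) \<le> J"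
  shows "(V / J) powr \<alpha> \<le> b powr (- \<alpha>) * e"
proof -
  have "0 < J" using less_le_trans[OF _ J, of 0] assms by simp
  then have "V / J \<le> V / (b * (V * e powr (- 1 / \<alpha>)))"
    using assms by (intro divide_left_mono mult_pos_pos) auto
  also have "\<dots> = b powr (-1) * e powr (1 / \<alpha>)"
    using assms by (simp add: powr_minus field_simps)
  finally have "(V / J) powr \<alpha> \<le> (b powr (-1) * e powr (1 / \<alpha>)) powr \<alpha>"
    using assms \<open>0 < J\<close> by (intro powr_mono2) auto
  also have "\<dots> = b powr (- \<alpha>) * e"
    using assms by (simp add: powr_divide powr_powr powr_minus_divide)
  finally show ?thesis .
qed

text \<open>This covers a vanishing DLQMC cost too: division by zero gives 0 on the left, and the
  right side is that cost over \<open>C * real Jq\<close>.\<close>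

lemma inverse_dlqmc_speedup:
  assumes "0 < C" "0 < Jq"
  shows "1 / dlqmc_speedup C Cs N Jq JL = real N / real Jq + Cs / C * (real JL / real Jq)"
  using assms by (simp add: dlqmc_speedup_def qmc_cost_def dlqmc_cost_def field_simps)

text \<open>The constants cross over: the lower one is \<open>a1 / b2\<close>, the upper one
  \<open>a2 / b1\<close>.\<close>

lemma comparable_on_divide:
  assumes "comparable_on X A A'" "comparable_on X B B'"
    and "\<And>x. x \<in> X \<Longrightarrow> 0 \<le> A' x" "\<And>x. x \<in> X \<Longrightarrow> 0 < B' x"
  shows "comparable_on X (\<lambda>x. A x / B x) (\<lambda>x. A' x / B' x)"
proof -
  obtain a1 a2 where a: "0 < a1" "a1 \<le> a2" "\<And>x. x \<in> X \<Longrightarrow> a1 * A' x \<le> A x \<and> A x \<le> a2 * A' x"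
    using assms(1) unfolding comparable_on_def by blast
  obtain b1 b2 where b: "0 < b1" "b1 \<le> b2" "\<And>x. x \<in> X \<Longrightarrow> b1 * B' x \<le> B x \<and> B x \<le> b2 * B' x"
    using assms(2) unfolding comparable_on_def by blast
  have "(a1 / b2) * (A' x / B' x) \<le> A x / B x \<and> A x / B x \<le> (a2 / b1) * (A' x / B' x)"
    if x: "x \<in> X" for x
  proof -
    have pos: "0 < b1 * B' x" "0 < B x" "0 \<le> a1 * A' x"
      using a b x assms(3,4)[OF x] by (auto intro: less_le_trans[OF mult_pos_pos])
    then have "a1 * A' x / (b2 * B' x) \<le> A x / B x" "A x / B x \<le> a2 * A' x / (b1 * B' x)"
      using a(3)[OF x] b(3)[OF x] by (intro frac_le; simp)+
    then show ?thesis by simp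
  qed
  moreover have "0 < a1 / b2" "a1 / b2 \<le> a2 / b1"
    using a b by (auto intro!: frac_le)
  ultimately show ?thesis unfolding comparable_on_def by blast
qed

lemma comparable_on_add_mult:
  assumes "comparable_on X A B" and "\<And>x. x \<in> X \<Longrightarrow> 0 \<le> F x" "\<And>x. x \<in> X \<Longrightarrow> 0 \<le> G x"
    and "\<And>x. x \<in> X \<Longrightarrow> 0 \<le> B x"
  shows "comparable_on X (\<lambda>x. F x + G x * A x) (\<lambda>x. F x + G x * B x)"
proof -
  obtain a1 a2 where a: "0 < a1" "a1 \<le> a2" "\<And>x. x \<in> X \<Longrightarrow> a1 * B x \<le> A x \<and> A x \<le> a2 * B x"
    using assms(1) unfolding comparable_on_def by blast
  \<comment> \<open>The summand \<open>F x\<close> is comparable to itself with constant 1, hence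
    the minimum and maximum with 1.\<close>
  have "min 1 a1 * (F x + G x * B x) \<le> F x + G x * A x
      \<and> F x + G x * A x \<le> max 1 a2 * (F x + G x * B x)" if x: "x \<in> X" for x
  proof -
    note nonneg = assms(2-4)[OF x]
    have F: "min 1 a1 * F x \<le> 1 * F x" "1 * F x \<le> max 1 a2 * F x"
      using nonneg by (intro mult_right_mono; simp)+
    have "min 1 a1 * B x \<le> a1 * B x" "a2 * B x \<le> max 1 a2 * B x"
      using nonneg by (intro mult_right_mono; simp)+
    then have "G x * (min 1 a1 * B x) \<le> G x * A x" "G x * A x \<le> G x * (max 1 a2 * B x)"
      using a(3)[OF x] nonneg by (intro mult_left_mono; simp)+
    with F show ?thesis by (simp add: algebra_simps)
  qed
  then show ?thesis
    using a(1) unfolding comparable_on_def by (intro exI[of _ "min 1 a1"] exI[of _ "max 1 a2"]) auto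
qed

text \<open>The index \<open>i\<close> bundles tolerance, maps, costs and point counts, so a
  constant chosen before \<open>i\<close> is uniform in all of them. The rates range over
  \<open>I \<times> {1..}\<close> because they are applied at counts that vary with
  \<open>i\<close>.\<close>

theorem theorem3p3:
  fixes y :: "nat \<Rightarrow> real ^ 'd"
    and \<alpha> :: real
    and p :: ennreal
    and I :: "'i set"
    and \<epsilon> V\<Delta> Vs C Cs :: "'i \<Rightarrow> real"
    and L\<Delta> Ls :: "'i \<Rightarrow> real ^ 'd \<Rightarrow> real"
    and net :: "'i \<Rightarrow> 'w \<Rightarrow> real ^ 'd \<Rightarrow> real"
    and train :: "'i \<Rightarrow> ((real ^ 'd) \<times> real) list \<Rightarrow> 'w"
    and N Jq JL :: "'i \<Rightarrow> nat"
  assumes "low_discrepancy y"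
    and "\<And>i. i \<in> I \<Longrightarrow> 0 < \<epsilon> i"
    and "\<And>i. i \<in> I \<Longrightarrow> 0 < C i"
    and "\<And>i. i \<in> I \<Longrightarrow> 0 < Cs i"
    and "\<And>i. i \<in> I \<Longrightarrow> L\<Delta> i \<in> borel_measurable \<mu>"
    and "\<And>i. i \<in> I \<Longrightarrow> finite_first_moment (push_forward (L\<Delta> i))"
    and "\<And>i. i \<in> I \<Longrightarrow> Ls i = trained_network (net i) (train i) y (L\<Delta> i) (N i)"
    and "\<And>i. i \<in> I \<Longrightarrow> N i \<le> JL i"
    and "\<And>i. i \<in> I \<Longrightarrow> Ls i \<in> borel_measurable \<mu>"
    and "\<And>i. i \<in> I \<Longrightarrow> finite_first_moment (push_forward (Ls i))"
    and generalization_error: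
      "1 \<le> p" "\<exists>c. \<forall>i\<in>I. Lp_dist p (L\<Delta> i) (Ls i) \<le> ennreal (c * \<epsilon> i)"
    and qmc_rate:
      "1 / 2 < \<alpha>" "\<alpha> \<le> 1" "\<And>i. i \<in> I \<Longrightarrow> 0 < V\<Delta> i"
      "comparable_on (I \<times> {1..})
         (\<lambda>(i, J). W1 (push_forward (L\<Delta> i)) (empirical_measure y (L\<Delta> i) J))
         (\<lambda>(i, J). (V\<Delta> i / real J) powr \<alpha>)"
    and surrogate_rate:
      "\<And>i. i \<in> I \<Longrightarrow> 0 < Vs i"
      "comparable_on (I \<times> {1..})
         (\<lambda>(i, J). W1 (push_forward (Ls i)) (empirical_measure y (Ls i) J))
         (\<lambda>(i, J). (Vs i / real J) powr \<alpha>)"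
    and "comparable_on I (\<lambda>i. real (Jq i)) (\<lambda>i. V\<Delta> i * \<epsilon> i powr (- 1 / \<alpha>))"
    and "comparable_on I (\<lambda>i. real (JL i)) (\<lambda>i. Vs i * \<epsilon> i powr (- 1 / \<alpha>))"
  shows "bigO_on I (\<lambda>i. W1 (push_forward (L\<Delta> i)) (empirical_measure y (L\<Delta> i) (Jq i))) \<epsilon>
       \<and> bigO_on I (\<lambda>i. W1 (push_forward (L\<Delta> i)) (empirical_measure y (Ls i) (JL i))) \<epsilon>
       \<and> comparable_on I (\<lambda>i. 1 / dlqmc_speedup (C i) (Cs i) (N i) (Jq i) (JL i))
           (\<lambda>i. real (N i) / real (Jq i) + Cs i / C i * (Vs i / V\<Delta> i))"
proof (intro conjI)
  note \<epsilon> = assms(2) and costs = assms(3,4) and meas = assms(5,9) and moment = assms(6,10)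
    and Jq = assms(19) and JL = assms(20)
  \<comment> \<open>The error bounds combine upper estimates from the rates with lower estimates for
    the point counts.\<close>
  obtain d1 d2 where d: "0 < d1" "d1 \<le> d2"
    "\<And>i J. i \<in> I \<Longrightarrow> 1 \<le> J \<Longrightarrow> W1 (push_forward (L\<Delta> i)) (empirical_measure y (L\<Delta> i) J)
        \<le> d2 * (V\<Delta> i / real J) powr \<alpha>"
    using qmc_rate(4) unfolding comparable_on_def by fastforce
  obtain s1 s2 where s: "0 < s1" "s1 \<le> s2"
    "\<And>i J. i \<in> I \<Longrightarrow> 1 \<le> J \<Longrightarrow> W1 (push_forward (Ls i)) (empirical_measure y (Ls i) J)
        \<le> s2 * (Vs i / real J) powr \<alpha>"
    using surrogate_rate(2) unfolding comparable_on_def by fastforce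
  obtain q1 where q: "0 < q1" "\<And>i. i \<in> I \<Longrightarrow> q1 * (V\<Delta> i * \<epsilon> i powr (- 1 / \<alpha>)) \<le> real (Jq i)"
    using Jq unfolding comparable_on_def by blast
  obtain l1 where l: "0 < l1" "\<And>i. i \<in> I \<Longrightarrow> l1 * (Vs i * \<epsilon> i powr (- 1 / \<alpha>)) \<le> real (JL i)"
    using JL unfolding comparable_on_def by blast
  obtain c where c: "\<And>i. i \<in> I \<Longrightarrow> Lp_dist p (L\<Delta> i) (Ls i) \<le> ennreal (c * \<epsilon> i)"
    using generalization_error(2) by blast
  have \<alpha>: "0 < \<alpha>" using qmc_rate(1) by simp
  \<comment> \<open>Positive counts place \<open>Jq i\<close> and \<open>JL i\<close> in the range
    where the rates hold and empirical measures are probability measures.\<close>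
  have Jq_pos: "0 < Jq i" if i: "i \<in> I" for i
    using less_le_trans[OF _ q(2)[OF i], of 0] q(1) \<epsilon>[OF i] qmc_rate(3)[OF i] by simp
  have JL_pos: "0 < JL i" if i: "i \<in> I" for i
    using less_le_trans[OF _ l(2)[OF i], of 0] l(1) \<epsilon>[OF i] surrogate_rate(1)[OF i] by simp

  have "W1 (push_forward (L\<Delta> i)) (empirical_measure y (L\<Delta> i) (Jq i)) \<le> d2 * q1 powr (- \<alpha>) * \<epsilon> i"
    if i: "i \<in> I" for i
  proof -
    have "(V\<Delta> i / real (Jq i)) powr \<alpha> \<le> q1 powr (- \<alpha>) * \<epsilon> i"
      using qmc_rate(3) \<epsilon> \<alpha> q i by (intro rate_le_tolerance) auto
    then have "d2 * (V\<Delta> i / real (Jq i)) powr \<alpha> \<le> d2 * (q1 powr (- \<alpha>) * \<epsilon> i)"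
      using d by (intro mult_left_mono) auto
    with d(3)[OF i, of "Jq i"] Jq_pos[OF i] show ?thesis by simp
  qed
  then show "bigO_on I (\<lambda>i. W1 (push_forward (L\<Delta> i)) (empirical_measure y (L\<Delta> i) (Jq i))) \<epsilon>"
    unfolding bigO_on_def by blast

  have "W1 (push_forward (L\<Delta> i)) (empirical_measure y (Ls i) (JL i))
      \<le> (max c 1 + s2 * l1 powr (- \<alpha>)) * \<epsilon> i" if i: "i \<in> I" for i
  proof -
    \<comment> \<open>The constant \<open>c\<close> may be zero or negative, whereas the surrogate
      bound asks for a positive \<open>B\<close>; hence \<open>max c 1\<close>.\<close>
    have "c * \<epsilon> i \<le> max c 1 * \<epsilon> i" using \<epsilon>[OF i] by (intro mult_right_mono) auto
    then have "Lp_dist p (L\<Delta> i) (Ls i) \<le> ennreal (max c 1 * \<epsilon> i)"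
      by (intro order_trans[OF c[OF i]] ennreal_leI)
    then have "W1 (push_forward (L\<Delta> i)) (empirical_measure y (Ls i) (JL i))
        \<le> max c 1 * \<epsilon> i + W1 (push_forward (Ls i)) (empirical_measure y (Ls i) (JL i))"
      using JL_pos meas moment generalization_error(1) \<epsilon>[OF i] i
      by (intro W1_push_forward_empirical_le) auto
    moreover have "(Vs i / real (JL i)) powr \<alpha> \<le> l1 powr (- \<alpha>) * \<epsilon> i"
      using surrogate_rate(1) \<epsilon> \<alpha> l i by (intro rate_le_tolerance) auto
    then have "s2 * (Vs i / real (JL i)) powr \<alpha> \<le> s2 * (l1 powr (- \<alpha>) * \<epsilon> i)"
      using s by (intro mult_left_mono) auto
    ultimately show ?thesis
      using s(3)[OF i, of "JL i"] JL_pos[OF i] by (simp add: distrib_right)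
  qed
  then show "bigO_on I (\<lambda>i. W1 (push_forward (L\<Delta> i)) (empirical_measure y (Ls i) (JL i))) \<epsilon>"
    unfolding bigO_on_def by blast

  \<comment> \<open>Both counts carry the same power of the tolerance because \<alpha> is shared; it
    cancels and leaves the ratio of the variations.\<close>
  have "comparable_on I (\<lambda>i. real (JL i) / real (Jq i))
      (\<lambda>i. (Vs i * \<epsilon> i powr (- 1 / \<alpha>)) / (V\<Delta> i * \<epsilon> i powr (- 1 / \<alpha>)))"
    using \<epsilon> qmc_rate(3) surrogate_rate(1)
    by (intro comparable_on_divide[OF JL Jq] mult_nonneg_nonneg mult_pos_pos) (force intro: less_imp_le)+
  moreover have "Vs i * \<epsilon> i powr (- 1 / \<alpha>) / (V\<Delta> i * \<epsilon> i powr (- 1 / \<alpha>)) = Vs i / V\<Delta> i" if "i \<in> I" for i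
    using \<epsilon>[OF that] by simp
  ultimately have "comparable_on I (\<lambda>i. real (JL i) / real (Jq i)) (\<lambda>i. Vs i / V\<Delta> i)"
    by (simp add: comparable_on_def)
  then have "comparable_on I (\<lambda>i. real (N i) / real (Jq i) + Cs i / C i * (real (JL i) / real (Jq i)))
      (\<lambda>i. real (N i) / real (Jq i) + Cs i / C i * (Vs i / V\<Delta> i))"
    using costs qmc_rate(3) surrogate_rate(1)
    by (intro comparable_on_add_mult) (auto simp: less_imp_le)
  then show "comparable_on I (\<lambda>i. 1 / dlqmc_speedup (C i) (Cs i) (N i) (Jq i) (JL i))
      (\<lambda>i. real (N i) / real (Jq i) + Cs i / C i * (Vs i / V\<Delta> i))"
    using inverse_dlqmc_speedup costs(1) Jq_pos unfolding comparable_on_def by simp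
qed
end
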